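(* Let $\mathcal{H}$ be a real Hilbert space. For every $k\in\mathbb{N}$ let $T_k:\mathcal{H}\to\mathcal{H}$ be $\alpha_k$-averaged with $\alpha_k\in(0,1]$, and suppose that there is a nonempty set $C$ with $\operatorname{Fix}T_k=C$ for every $k\in\mathbb{N}$. Let $\bar x\in C$, let $\lambda_k\in(0,\tfrac1{\alpha_k})$ for every $k\in\mathbb{N}$, let $(\eta_k)_{k\in\mathbb{N}}$ be in $\mathbb{R}_+$ and let $(e_k)_{k\in\mathbb{N}}$ be in $\mathcal{H}$. Suppose that for every $k\in\mathbb{N}$ the operator $\operatorname{Id}-T_k$ is metrically subregular at $\bar x$ for $0=(\operatorname{Id}-T_k)\bar x$, i.e. for every $k\in\mathbb{N}$ there exist $\gamma_k>0$ and $\delta_k>0$ such that $$(\forall x\in B[\bar x;\delta_k])\quad \operatorname{d}\left(x,(\operatorname{Id}-T_k)^{-1}0\right)\le\gamma_k\|x-T_kx\| .$$ Suppose that $\delta:=\inf_{k\in\mathbb{N}}\delta_k>0$ and that $\epsilon:=\sum_{k\in\mathbb{N}}\eta_k\|e_k\|<\delta$. Suppose that $0<\underline\lambda:=\liminf_{k\to\infty}\lambda_k\le\overline\lambda:=\limsup_{k\to\infty}\lambda_k<\frac1\alpha$, where $\alpha:=\limsup_{k\to\infty}\alpha_k>0$, and $\gamma:=\limsup_{k\to\infty}\gamma_k<\infty$. Let $\hat\delta\in(0,\delta-\epsilon]$ and let $x_0\in B[\bar x;\hat\delta]$. Define $$(\forall k\in\mathbb{N})\quad x_{k+1}=(1-\lambda_k)x_k+\lambda_kT_kx_k+\eta_ke_k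 .$$ Then $(x_k)_{k\in\mathbb{N}}$ converges strongly to a point in $C$. In particular, if $C$ is affine, then $(x_k)_{k\in\mathbb{N}}$ converges strongly to $\operatorname{P}_Cx_0$.
   Context: $\mathbb{N}=\{0,1,2,\ldots\}$, $\mathbb{R}_+=[0,\infty)$. An operator $R:\mathcal{H}\to\mathcal{H}$ is nonexpansive if $\|Rx-Ry\|\le\|x-y\|$ for all $x,y$. For $\alpha\in(0,1]$, $T:\mathcal{H}\to\mathcal{H}$ is $\alpha$-averaged if there is a nonexpansive $R:\mathcal{H}\to\mathcal{H}$ with $T=(1-\alpha)\operatorname{Id}+\alpha R$. $\operatorname{Fix}T=\{x:Tx=x\}$; $(\operatorname{Id}-T)^{-1}0=\operatorname{Fix}T$. $B[\bar x;r]=\{y\in\mathcal{H}:\|y-\bar x\|\le r\}$; $\operatorname{d}(x,C)=\inf_{y\in C}\|x-y\|$; $\operatorname{P}_C$ is the projection onto the nonempty closed convex set $C$. A nonempty set $C$ is affine if $\lambda x+(1-\lambda)y\in C$ for all $x,y\in C$ and $\lambda\in\mathbb{R}$. Strong convergence means convergence in norm.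
   Formalization: For affine C the limit is stated as P_C(x_0 + sum of eta_k e_k), which equals P_C x_0 when all errors eta_k e_k vanish; the claimed limit P_C x_0 fails with nonzero errors, e.g. T_k = Id, C = R, x_0 = 0, eta_0 e_0 = 1/2 and no later errors. *)

theory Defs
  imports "HOL-Analysis.Analysis"
begin

definition nonexpansive :: "('a::real_normed_vector \<Rightarrow> 'a) \<Rightarrow> bool"
  where "nonexpansive R \<longleftrightarrow> (\<forall>x y. norm (R x - R y) \<le> norm (x - y))"

definition averaged :: "real \<Rightarrow> ('a::real_normed_vector \<Rightarrow> 'a) \<Rightarrow> bool"
  where "averaged \<alpha> T \<longleftrightarrow>
    0 < \<alpha> \<and> \<alpha> \<le> 1 \<and>
    (\<exists>R. nonexpansive R \<and> (\<forall>x. T x = (1 - \<alpha>) *\<^sub>R x + \<alpha> *\<^sub>R R x))"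

definition Fix :: "('a \<Rightarrow> 'a) \<Rightarrow> 'a set"
  where "Fix T = {x. T x = x}"

text \<open>
  Metric subregularity of a single-valued map \<open>F\<close> at \<open>xbar\<close> for \<open>ybar\<close>, with explicit
  constants \<open>\<gamma>\<close> and \<open>\<delta>\<close>. The preimage contains \<open>xbar\<close>, so the convention that \<^const>\<open>infdist\<close>
  to the empty set is zero plays no role.
\<close>

definition metrically_subregular_with ::
  "('a::real_normed_vector \<Rightarrow> 'b::real_normed_vector) \<Rightarrow> 'a \<Rightarrow> 'b \<Rightarrow> real \<Rightarrow> real \<Rightarrow> bool"
  where "metrically_subregular_with F xbar ybar \<gamma> \<delta> \<longleftrightarrow>
    F xbar = ybar \<and> \<gamma> > 0 \<and> \<delta> > 0 \<and>
    (\<forall>x\<in>cball xbar \<delta>. infdist x (F -` {ybar}) \<le> \<gamma> * norm (F x - ybar))"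

text \<open>
  The library's \<^const>\<open>closest_point\<close> needs the class \<^class>\<open>heine_borel\<close>, which excludes
  infinite-dimensional Hilbert spaces. The description below is meaningful when \<open>C\<close> is nonempty,
  closed and convex and the space is complete.
\<close>

definition metric_projection :: "'a::real_inner set \<Rightarrow> 'a \<Rightarrow> 'a"
  where "metric_projection C x = (THE p. p \<in> C \<and> (\<forall>y\<in>C. norm (x - p) \<le> norm (x - y)))"

end

theory Submission
  imports Defs
begin

text \<open>
  Write \<open>S\<^sub>k = (1 - \<lambda>\<^sub>k) Id + \<lambda>\<^sub>k T\<^sub>k\<close> for the relaxed operator, so that the iteration is
  \<open>x\<^sub>k\<^sub>+\<^sub>1 = S\<^sub>k x\<^sub>k + \<eta>\<^sub>k e\<^sub>k\<close>. Two facts about \<open>S\<^sub>k\<close> carry the proof.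

  Firstly, averagedness gives
  \<open>\<parallel>S\<^sub>k u - z\<parallel>\<^sup>2 \<le> \<parallel>u - z\<parallel>\<^sup>2 - \<lambda>\<^sub>k (1/\<alpha>\<^sub>k - \<lambda>\<^sub>k) \<parallel>u - T\<^sub>k u\<parallel>\<^sup>2\<close> for each fixed point \<open>z\<close>
  (lemma \<open>averaged_relaxation_norm_sq\<close>). Thus \<open>S\<^sub>k\<close> moves no point away from \<open>C\<close>, so the iterates
  are quasi-Fejer monotone with respect to \<open>C\<close>: the distance to a point of \<open>C\<close> grows, in
  total, by at most the sum of the perturbations. This keeps all iterates in the ball
  of radius \<open>\<delta>\<close> around \<open>xbar\<close>, where metric subregularity applies.

  Secondly, subregularity replaces \<open>\<parallel>u - T\<^sub>k u\<parallel>\<close> by a multiple of the distance from \<open>u\<close> to \<open>C\<close>.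
  The conditions on the limits superior and inferior make the constants uniform for large \<open>k\<close>, so
  \<open>S\<^sub>k\<close> shrinks the distance to \<open>C\<close> by a fixed factor below 1 (lemma \<open>infdist_contraction\<close>). With
  summable perturbations this drives the distance of \<open>x\<^sub>k\<close> to \<open>C\<close> to zero.

  A quasi-Fejer sequence whose distance to \<open>C\<close> tends to zero is Cauchy, because after step
  \<open>n\<close> it stays in a small ball around any point of \<open>C\<close> near \<open>x\<^sub>n\<close> (lemma
  \<open>quasi_Fejer_convergent\<close>). Since \<open>C\<close> is closed, the limit \<open>z\<close> lies in \<open>C\<close>.

  If \<open>C\<close> is affine, moving a point without increasing its distance to any point of \<open>C\<close> is possible
  only orthogonally to \<open>C\<close> (lemma \<open>closer_to_affine_imp_orthogonal\<close>). Hence, apart from the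
  perturbations, all steps are orthogonal to \<open>C\<close>, so \<open>x\<^sub>0 + (\<Sum>k. \<eta>\<^sub>k e\<^sub>k) - z\<close> is orthogonal to \<open>C\<close>,
  which says that \<open>z\<close> is the projection of \<open>x\<^sub>0 + (\<Sum>k. \<eta>\<^sub>k e\<^sub>k)\<close> onto \<open>C\<close>.
\<close>

section \<open>Relaxations of averaged operators\<close>

lemma averaged_imp_nonexpansive:
  fixes T :: "'a::real_normed_vector \<Rightarrow> 'a"
  assumes "averaged \<alpha> T"
  shows "nonexpansive T"
proof -
  obtain R where \<alpha>: "0 < \<alpha>" "\<alpha> \<le> 1" and R: "nonexpansive R"
    and T: "\<And>u. T u = (1 - \<alpha>) *\<^sub>R u + \<alpha> *\<^sub>R R u"
    using assms unfolding averaged_def by blast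
  have "norm (T u - T v) \<le> norm (u - v)" for u v
  proof -
    have "T u - T v = (1 - \<alpha>) *\<^sub>R (u - v) + \<alpha> *\<^sub>R (R u - R v)"
      by (simp add: T algebra_simps)
    then have "norm (T u - T v) \<le> (1 - \<alpha>) * norm (u - v) + \<alpha> * norm (R u - R v)"
      using norm_triangle_ineq[of "(1 - \<alpha>) *\<^sub>R (u - v)" "\<alpha> *\<^sub>R (R u - R v)"] \<alpha> by simp
    also have "\<dots> \<le> (1 - \<alpha>) * norm (u - v) + \<alpha> * norm (u - v)"
      using R \<alpha> by (intro add_left_mono mult_left_mono) (auto simp: nonexpansive_def)
    finally show ?thesis by (simp add: algebra_simps)
  qed
  then show ?thesis by (simp add: nonexpansive_def)
qed

lemma closed_Fix_nonexpansive:
  fixes T :: "'a::real_normed_vector \<Rightarrow> 'a"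
  assumes "nonexpansive T"
  shows "closed (Fix T)"
proof -
  have "1-lipschitz_on UNIV T"
    using assms by (intro lipschitz_onI) (auto simp: nonexpansive_def dist_norm)
  then have "continuous_on UNIV T" by (rule lipschitz_on_continuous_on)
  then show ?thesis unfolding Fix_def by (intro closed_Collect_eq continuous_on_id)
qed

lemma norm_sq_convex_combination:
  fixes a b :: "'a::real_inner"
  shows "(norm ((1 - t) *\<^sub>R a + t *\<^sub>R b))\<^sup>2
    = (1 - t) * (norm a)\<^sup>2 + t * (norm b)\<^sup>2 - t * (1 - t) * (norm (a - b))\<^sup>2"
  unfolding power2_norm_eq_inner
  by (simp add: inner_add_left inner_add_right inner_diff_left inner_diff_right
      inner_commute[of b a] algebra_simps)

text \<open>
  If \<open>T\<close> is averaged through the nonexpansive map \<open>R\<close>, its relaxation is the convex combination of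
  the identity and \<open>R\<close> with weight \<open>\<beta> = l \<alpha>\<close>, and \<open>R\<close> fixes \<open>z\<close> too. The identity for
  squared norms of convex combinations then gives the term \<open>- \<beta> (1 - \<beta>) \<parallel>u - R u\<parallel>\<^sup>2\<close>, and
  \<open>u - R u = (u - T u) / \<alpha>\<close>.
\<close>

lemma averaged_relaxation_norm_sq:
  fixes T :: "'a::real_inner \<Rightarrow> 'a"
  assumes "averaged \<alpha> T" and z: "z \<in> Fix T" and l: "0 \<le> l"
  shows "(norm ((1 - l) *\<^sub>R u + l *\<^sub>R T u - z))\<^sup>2
    \<le> (norm (u - z))\<^sup>2 - l * (1 / \<alpha> - l) * (norm (u - T u))\<^sup>2"
proof -
  obtain R where \<alpha>: "0 < \<alpha>" and R: "nonexpansive R"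
    and T: "\<And>u. T u = (1 - \<alpha>) *\<^sub>R u + \<alpha> *\<^sub>R R u"
    using assms(1) unfolding averaged_def by blast
  define \<beta> where "\<beta> = l * \<alpha>"
  have "\<alpha> *\<^sub>R (R z - z) = 0"
    using z T[of z] by (simp add: Fix_def algebra_simps)
  then have Rz: "R z = z" using \<alpha> by simp
  have comb: "(1 - l) *\<^sub>R u + l *\<^sub>R T u - z = (1 - \<beta>) *\<^sub>R (u - z) + \<beta> *\<^sub>R (R u - z)"
    by (simp add: T \<beta>_def algebra_simps)
  have "u - T u = \<alpha> *\<^sub>R (u - R u)"
    by (simp add: T algebra_simps)
  then have residual: "(norm (u - T u))\<^sup>2 = \<alpha>\<^sup>2 * (norm (u - R u))\<^sup>2"
    by (simp add: power_mult_distrib)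
  have "norm (R u - z) \<le> norm (u - z)"
    using R Rz unfolding nonexpansive_def by metis
  then have "(norm (R u - z))\<^sup>2 \<le> (norm (u - z))\<^sup>2"
    by (intro power_mono) auto
  then have "\<beta> * (norm (R u - z))\<^sup>2 \<le> \<beta> * (norm (u - z))\<^sup>2"
    using l \<alpha> by (intro mult_left_mono) (auto simp: \<beta>_def)
  then have "(norm ((1 - l) *\<^sub>R u + l *\<^sub>R T u - z))\<^sup>2
      \<le> (norm (u - z))\<^sup>2 - \<beta> * (1 - \<beta>) * (norm (u - R u))\<^sup>2"
    unfolding comb norm_sq_convex_combination by (simp add: algebra_simps)
  also have "\<beta> * (1 - \<beta>) * (norm (u - R u))\<^sup>2 = l * (1 / \<alpha> - l) * (norm (u - T u))\<^sup>2"
    unfolding residual \<beta>_def using \<alpha> by (simp add: field_simps power2_eq_square)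
  finally show ?thesis .
qed

lemma averaged_relaxation_norm_le:
  fixes T :: "'a::real_inner \<Rightarrow> 'a"
  assumes "averaged \<alpha> T" and "z \<in> Fix T" and "0 \<le> l" and "l \<le> 1 / \<alpha>"
  shows "norm ((1 - l) *\<^sub>R u + l *\<^sub>R T u - z) \<le> norm (u - z)"
proof (rule power2_le_imp_le)
  have "0 \<le> l * (1 / \<alpha> - l) * (norm (u - T u))\<^sup>2"
    using assms(3,4) by simp
  then show "(norm ((1 - l) *\<^sub>R u + l *\<^sub>R T u - z))\<^sup>2 \<le> (norm (u - z))\<^sup>2"
    using averaged_relaxation_norm_sq[OF assms(1-3), of u] by linarith
qed simp

section \<open>Decay of the distance to the fixed point set\<close>

text \<open>
  The factor \<open>1 - \<kappa>/2\<close> is a square-root-free upper bound for \<open>sqrt (1 - \<kappa>)\<close>, the factor that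
  results from taking the infimum over \<open>z\<close> in the hypothesis.
\<close>

lemma infdist_contraction:
  fixes u s :: "'a::real_normed_vector"
  assumes "C \<noteq> {}" and \<kappa>: "\<kappa> \<le> 1"
    and closer: "\<And>z. z \<in> C \<Longrightarrow> (norm (s - z))\<^sup>2 \<le> (norm (u - z))\<^sup>2 - \<kappa> * (infdist u C)\<^sup>2"
  shows "infdist s C \<le> (1 - \<kappa> / 2) * infdist u C"
proof -
  let ?E = "(infdist s C)\<^sup>2 + \<kappa> * (infdist u C)\<^sup>2"
  have "sqrt ?E \<le> dist u z" if "z \<in> C" for z
  proof (rule real_le_lsqrt)
    have "(infdist s C)\<^sup>2 \<le> (norm (s - z))\<^sup>2"
      using infdist_le[OF that, of s] by (intro power_mono) (auto simp: dist_norm infdist_nonneg)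
    then show "?E \<le> (dist u z)\<^sup>2"
      using closer[OF that] by (simp add: dist_norm)
  qed simp
  then have "sqrt ?E \<le> infdist u C"
    unfolding infdist_notempty[OF assms(1)] by (intro cINF_greatest assms(1)) auto
  then have "?E \<le> (infdist u C)\<^sup>2"
    by (simp add: sqrt_le_D)
  then have "(infdist s C)\<^sup>2 \<le> (1 - \<kappa>) * (infdist u C)\<^sup>2"
    by (simp add: algebra_simps)
  also have "\<dots> \<le> (1 - \<kappa> / 2)\<^sup>2 * (infdist u C)\<^sup>2"
    by (intro mult_right_mono) (auto simp: power2_eq_square algebra_simps)
  also have "\<dots> = ((1 - \<kappa> / 2) * infdist u C)\<^sup>2"
    by (simp add: power_mult_distrib)
  finally show ?thesis
    using \<kappa> infdist_nonneg[of u C] by (intro power2_le_imp_le[OF _ mult_nonneg_nonneg]) auto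
qed

text \<open>
  Summing the recursion bounds \<open>(1 - q) * (\<Sum>k<n. d k)\<close> by \<open>d 0\<close> plus the sum of the
  perturbations, so \<open>d\<close> is even summable.
\<close>

lemma perturbed_contraction_tendsto_zero:
  fixes d a :: "nat \<Rightarrow> real"
  assumes d: "\<And>k. 0 \<le> d k" and q: "q < 1" and a: "summable a" "\<And>k. 0 \<le> a k"
    and rec: "\<And>k. d (Suc k) \<le> q * d k + a k"
  shows "d \<longlonglongrightarrow> 0"
proof -
  have partial: "(1 - q) * (\<Sum>k<n. d k) + d n \<le> d 0 + (\<Sum>k<n. a k)" for n
  proof (induction n)
    case (Suc n)
    then show ?case using rec[of n] by (simp add: algebra_simps)
  qed simp
  have "(\<Sum>k<n. d k) \<le> (d 0 + suminf a) / (1 - q)" for n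
  proof -
    have "(\<Sum>k<n. a k) \<le> suminf a"
      using a by (intro sum_le_suminf) auto
    then have "(1 - q) * (\<Sum>k<n. d k) \<le> d 0 + suminf a"
      using partial[of n] d[of n] by linarith
    then show ?thesis using q by (simp add: field_simps)
  qed
  then have "summable d"
    using d by (intro summableI_nonneg_bounded)
  then show ?thesis by (rule summable_LIMSEQ_zero)
qed

section \<open>Quasi-Fejer monotone sequences\<close>

lemma convergent_of_vanishing_tail_bound:
  fixes y :: "nat \<Rightarrow> 'a::complete_space"
  assumes bound: "\<And>m n. n \<le> m \<Longrightarrow> dist (y m) (y n) \<le> b n" and b: "b \<longlonglongrightarrow> 0"
  shows "convergent y"
proof -
  have "\<exists>M. \<forall>m>M. dist (y M) (y m) < r" if r: "r > 0" for r :: real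
  proof -
    obtain N where "b N < r"
      using order_tendstoD(2)[OF b r] by (auto simp: eventually_sequentially)
    then show ?thesis
      using bound by (metis dist_commute less_imp_le le_less_trans)
  qed
  then have "Cauchy y"
    unfolding Cauchy_altdef2 by (metis dist_commute dist_self le_neq_implies_less)
  then show ?thesis by (rule Cauchy_convergent)
qed

lemma quasi_Fejer_dist_le:
  fixes x :: "nat \<Rightarrow> 'a::metric_space" and a :: "nat \<Rightarrow> real"
  assumes step: "\<And>k. dist (x (Suc k)) z \<le> dist (x k) z + a k" and "n \<le> m"
  shows "dist (x m) z \<le> dist (x n) z + (\<Sum>k=n..<m. a k)"
  using \<open>n \<le> m\<close>
proof (induction m rule: dec_induct)
  case (step m)
  then show ?case using assms(1)[of m] by simp
qed simp

lemma tail_sum_le: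
  fixes a :: "nat \<Rightarrow> real"
  assumes "a sums \<epsilon>" and "\<And>k. 0 \<le> a k" and "n \<le> m"
  shows "(\<Sum>k=n..<m. a k) \<le> \<epsilon> - (\<Sum>k<n. a k)"
proof -
  have "(\<Sum>k<m. a k) = (\<Sum>k<n. a k) + (\<Sum>k=n..<m. a k)"
    using sum.atLeastLessThan_concat[of 0 n m a] assms(3) by (simp add: atLeast0LessThan)
  moreover have "(\<Sum>k<m. a k) \<le> \<epsilon>"
    using sum_le_suminf[of a "{..<m}"] assms(1,2) by (simp add: sums_iff)
  ultimately show ?thesis by simp
qed

lemma tail_sum_tendsto_zero:
  fixes a :: "nat \<Rightarrow> real"
  assumes "a sums \<epsilon>"
  shows "(\<lambda>n. \<epsilon> - (\<Sum>k<n. a k)) \<longlonglongrightarrow> 0"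
  using tendsto_diff[OF tendsto_const, of _ \<epsilon> sequentially \<epsilon>] assms by (simp add: sums_def)

text \<open>
  The argument is that of \<open>summable_norm_cancel\<close>, for the two classes \<^class>\<open>real_normed_vector\<close> and
  \<^class>\<open>complete_space\<close>, which together do not entail \<^class>\<open>banach\<close> in the class hierarchy.
\<close>

lemma summable_of_sums_norm:
  fixes f :: "nat \<Rightarrow> 'a::{real_normed_vector, complete_space}"
  assumes "(\<lambda>k. norm (f k)) sums \<epsilon>"
  shows "summable f"
  unfolding summable_iff_convergent
proof (rule convergent_of_vanishing_tail_bound)
  show "(\<lambda>n. \<epsilon> - (\<Sum>k<n. norm (f k))) \<longlonglongrightarrow> 0"
    using assms by (rule tail_sum_tendsto_zero)
  fix m n :: nat
  assume "n \<le> m"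
  then have "(\<Sum>k<m. f k) - (\<Sum>k<n. f k) = (\<Sum>k=n..<m. f k)"
    using sum.atLeastLessThan_concat[of 0 n m f] by (simp add: atLeast0LessThan algebra_simps)
  then have "dist (\<Sum>k<m. f k) (\<Sum>k<n. f k) \<le> (\<Sum>k=n..<m. norm (f k))"
    by (simp add: dist_norm norm_sum)
  also have "\<dots> \<le> \<epsilon> - (\<Sum>k<n. norm (f k))"
    using assms \<open>n \<le> m\<close> by (intro tail_sum_le) auto
  finally show "dist (\<Sum>k<m. f k) (\<Sum>k<n. f k) \<le> \<epsilon> - (\<Sum>k<n. norm (f k))" .
qed

text \<open>
  Let \<open>t n\<close> be the sum of the perturbations from step \<open>n\<close> on. By the triangle inequality through
  a point \<open>z\<close> of \<open>C\<close>, \<open>dist (x m) (x n) \<le> 2 * dist (x n) z + t n\<close> for \<open>m \<ge> n\<close>; minimising over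
  \<open>z\<close> bounds the left-hand side by \<open>2 * infdist (x n) C + t n\<close>, which tends to zero.
\<close>

lemma quasi_Fejer_convergent:
  fixes x :: "nat \<Rightarrow> 'a::complete_space" and a :: "nat \<Rightarrow> real"
  assumes C: "C \<noteq> {}" "closed C"
    and a: "a sums \<epsilon>" "\<And>k. 0 \<le> a k"
    and step: "\<And>k z. z \<in> C \<Longrightarrow> dist (x (Suc k)) z \<le> dist (x k) z + a k"
    and infdist_lim: "(\<lambda>k. infdist (x k) C) \<longlonglongrightarrow> 0"
  shows "\<exists>z\<in>C. x \<longlonglongrightarrow> z"
proof -
  let ?t = "\<lambda>n. \<epsilon> - (\<Sum>k<n. a k)"
  have "convergent x"
  proof (rule convergent_of_vanishing_tail_bound)
    show "(\<lambda>n. 2 * infdist (x n) C + ?t n) \<longlonglongrightarrow> 0"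
      using tendsto_add[OF tendsto_mult_left[OF infdist_lim, of 2] tail_sum_tendsto_zero[OF a(1)]]
      by simp
    fix m n :: nat
    assume "n \<le> m"
    have "(dist (x m) (x n) - ?t n) / 2 \<le> dist (x n) z" if "z \<in> C" for z
    proof -
      have "dist (x m) z \<le> dist (x n) z + (\<Sum>k=n..<m. a k)"
        using step that \<open>n \<le> m\<close> by (intro quasi_Fejer_dist_le)
      moreover have "(\<Sum>k=n..<m. a k) \<le> ?t n"
        using a \<open>n \<le> m\<close> by (rule tail_sum_le)
      moreover have "dist (x m) (x n) \<le> dist (x m) z + dist (x n) z"
        by (rule dist_triangle2)
      ultimately show ?thesis by simp
    qed
    then have "(dist (x m) (x n) - ?t n) / 2 \<le> infdist (x n) C"
      unfolding infdist_notempty[OF C(1)] by (intro cINF_greatest C(1)) auto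
    then show "dist (x m) (x n) \<le> 2 * infdist (x n) C + ?t n" by simp
  qed
  then obtain z where z: "x \<longlonglongrightarrow> z" unfolding convergent_def by blast
  then have "(\<lambda>k. infdist (x k) C) \<longlonglongrightarrow> infdist z C" by (rule tendsto_infdist)
  then have "infdist z C = 0" using infdist_lim LIMSEQ_unique by blast
  then have "z \<in> C" using C in_closed_iff_infdist_zero by blast
  then show ?thesis using z by blast
qed

section \<open>Projections onto affine sets\<close>

text \<open>
  On the line \<open>z + t (y - z)\<close> in \<open>C\<close>, the difference of the squared distances from \<open>u\<close> and from
  \<open>s\<close> is an affine function of \<open>t\<close> with slope \<open>2 ((s - u) \<bullet> (y - z))\<close>. It is nonnegative for all
  real \<open>t\<close>, so its slope is zero.
\<close>

lemma closer_to_affine_imp_orthogonal: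
  fixes u s :: "'a::real_inner"
  assumes C: "affine C" "z \<in> C" "y \<in> C"
    and closer: "\<And>w. w \<in> C \<Longrightarrow> norm (s - w) \<le> norm (u - w)"
  shows "(s - u) \<bullet> (y - z) = 0"
proof (rule ccontr)
  let ?v = "y - z" and ?D = "(norm (u - z))\<^sup>2 - (norm (s - z))\<^sup>2"
  let ?p = "(s - u) \<bullet> ?v"
  assume p: "?p \<noteq> 0"
  have nonneg: "0 \<le> ?D + 2 * t * ?p" for t
  proof -
    have "z + t *\<^sub>R ?v = (1 - t) *\<^sub>R z + t *\<^sub>R y"
      by (simp add: algebra_simps)
    then have "z + t *\<^sub>R ?v \<in> C"
      using C unfolding affine_def by simp
    then have "(norm (s - (z + t *\<^sub>R ?v)))\<^sup>2 \<le> (norm (u - (z + t *\<^sub>R ?v)))\<^sup>2"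
      by (intro power_mono closer) auto
    moreover have expand: "(norm (w - (z + t *\<^sub>R ?v)))\<^sup>2
        = (norm (w - z))\<^sup>2 - 2 * t * (w \<bullet> ?v - z \<bullet> ?v) + t\<^sup>2 * (norm ?v)\<^sup>2" for w
    proof -
      have "(norm (w - z - t *\<^sub>R ?v))\<^sup>2
          = (norm (w - z))\<^sup>2 - 2 * ((w - z) \<bullet> t *\<^sub>R ?v) + (norm (t *\<^sub>R ?v))\<^sup>2"
        using dot_norm_neg[of "w - z" "t *\<^sub>R ?v"] by argo
      moreover have "w - (z + t *\<^sub>R ?v) = w - z - t *\<^sub>R ?v"
        by (rule diff_diff_eq[symmetric])
      ultimately show ?thesis
        by (simp only: norm_scaleR power_mult_distrib power2_abs inner_scaleR_right
            inner_diff_left[of w z] mult.assoc)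
    qed
    ultimately show ?thesis
      unfolding expand by (simp add: inner_diff_left algebra_simps)
  qed
  show False
    \<comment> \<open>at this \<open>t\<close> the affine function takes the value \<open>-1\<close>\<close>
    using nonneg[of "- (?D + 1) / (2 * ?p)"] p by (simp add: field_simps)
qed

lemma metric_projection_eqI:
  fixes w z :: "'a::real_inner"
  assumes "z \<in> C" and orth: "\<And>y. y \<in> C \<Longrightarrow> (w - z) \<bullet> (y - z) = 0"
  shows "metric_projection C w = z"
proof -
  have pythagoras: "(norm (w - y))\<^sup>2 = (norm (w - z))\<^sup>2 + (norm (y - z))\<^sup>2" if "y \<in> C" for y
    using dot_norm_neg[of "w - z" "y - z"] orth[OF that] by simp
  show ?thesis
    unfolding metric_projection_def
  proof (rule the_equality)
    have "norm (w - z) \<le> norm (w - y)" if "y \<in> C" for y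
      by (rule power2_le_imp_le) (simp_all add: pythagoras[OF that])
    then show "z \<in> C \<and> (\<forall>y\<in>C. norm (w - z) \<le> norm (w - y))"
      using assms(1) by blast
  next
    fix p
    assume p: "p \<in> C \<and> (\<forall>y\<in>C. norm (w - p) \<le> norm (w - y))"
    then have "(norm (w - p))\<^sup>2 \<le> (norm (w - z))\<^sup>2"
      using assms(1) by (intro power_mono) auto
    then have "(norm (p - z))\<^sup>2 \<le> 0"
      using pythagoras[of p] p by linarith
    then show "p = z" by simp
  qed
qed

section \<open>Convergence of the perturbed iteration\<close>

theorem theorem4p11:
  fixes T :: "nat \<Rightarrow> 'a::{real_inner, complete_space} \<Rightarrow> 'a"
    and C :: "'a set" and xbar :: 'a
    and \<alpha>s lam \<eta> \<gamma>s \<delta>s :: "nat \<Rightarrow> real"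
    and e x :: "nat \<Rightarrow> 'a"
    and \<alpha> \<delta> \<epsilon> \<delta>hat :: real
  assumes averaged: "\<And>k. averaged (\<alpha>s k) (T k)"
    and C_nonempty: "C \<noteq> {}"
    and Fix_eq: "\<And>k. Fix (T k) = C"
    and xbar: "xbar \<in> C"
    and lam: "\<And>k. 0 < lam k \<and> lam k < 1 / \<alpha>s k"
    and \<eta>: "\<And>k. 0 \<le> \<eta> k"
    and subregular:
      "\<And>k. metrically_subregular_with (\<lambda>u. u - T k u) xbar 0 (\<gamma>s k) (\<delta>s k)"
    and \<delta>_eq: "\<delta> = (INF k. \<delta>s k)" and \<delta>_pos: "\<delta> > 0"
    and \<epsilon>_sum: "(\<lambda>k. \<eta> k * norm (e k)) sums \<epsilon>" and \<epsilon>_less: "\<epsilon> < \<delta>"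
    and \<alpha>_limsup: "limsup (\<lambda>k. ereal (\<alpha>s k)) = ereal \<alpha>" and \<alpha>_pos: "\<alpha> > 0"
    and lam_liminf: "0 < liminf (\<lambda>k. ereal (lam k))"
    and lam_limsup: "limsup (\<lambda>k. ereal (lam k)) < ereal (1 / \<alpha>)"
    and \<gamma>_limsup: "limsup (\<lambda>k. ereal (\<gamma>s k)) < \<infinity>"
    and \<delta>hat: "0 < \<delta>hat" "\<delta>hat \<le> \<delta> - \<epsilon>"
    and x_0: "x 0 \<in> cball xbar \<delta>hat"
    and x_Suc: "\<And>k. x (Suc k) =
      (1 - lam k) *\<^sub>R x k + lam k *\<^sub>R T k (x k) + \<eta> k *\<^sub>R e k"
  shows "(\<exists>z\<in>C. x \<longlonglongrightarrow> z) \<and>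
    (affine C \<longrightarrow>
      x \<longlonglongrightarrow> metric_projection C (x 0 + (\<Sum>k. \<eta> k *\<^sub>R e k)) \<and>
      ((\<forall>k. \<eta> k *\<^sub>R e k = 0) \<longrightarrow> x \<longlonglongrightarrow> metric_projection C (x 0)))"
proof -
  define S where "S k u = (1 - lam k) *\<^sub>R u + lam k *\<^sub>R T k u" for k u
  define a where "a k = \<eta> k * norm (e k)" for k
  have x_step: "x (Suc k) = S k (x k) + \<eta> k *\<^sub>R e k" for k
    by (simp add: x_Suc S_def)
  have a_nonneg: "0 \<le> a k" for k
    using \<eta> by (simp add: a_def)
  have a_norm: "norm (\<eta> k *\<^sub>R e k) = a k" for k
    using \<eta> by (simp add: a_def)
  have a_sums: "a sums \<epsilon>"
    using \<epsilon>_sum unfolding a_def .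
  have closed: "closed C"
    using closed_Fix_nonexpansive[OF averaged_imp_nonexpansive[OF averaged[of 0]]] Fix_eq by simp
  have S_closer: "norm (S k u - z) \<le> norm (u - z)" if "z \<in> C" for k u z
    unfolding S_def using averaged[of k] Fix_eq[of k] lam[of k] that
    by (intro averaged_relaxation_norm_le) auto
  have Fejer: "dist (x (Suc k)) z \<le> dist (x k) z + a k" if "z \<in> C" for k z
  proof -
    have "x (Suc k) - z = (S k (x k) - z) + \<eta> k *\<^sub>R e k"
      by (simp add: x_step)
    then have "norm (x (Suc k) - z) \<le> norm (S k (x k) - z) + a k"
      using norm_triangle_ineq[of "S k (x k) - z" "\<eta> k *\<^sub>R e k"] by (simp only: a_norm)
    then show ?thesis
      using S_closer[OF that, of k "x k"] by (simp add: dist_norm)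
  qed

  have in_ball: "x k \<in> cball xbar (\<delta>s k)" for k
  proof -
    have "dist (x k) xbar \<le> dist (x 0) xbar + (\<Sum>i=0..<k. a i)"
      using Fejer[OF xbar] by (intro quasi_Fejer_dist_le) auto
    also have "(\<Sum>i=0..<k. a i) \<le> \<epsilon>"
      using tail_sum_le[OF a_sums a_nonneg, of 0 k] by simp
    also have "dist (x 0) xbar \<le> \<delta>hat"
      using x_0 by (simp add: dist_commute)
    also have "\<delta>hat + \<epsilon> \<le> \<delta>"
      using \<delta>hat by simp
    also have "\<delta> \<le> \<delta>s k"
      unfolding \<delta>_eq using subregular unfolding metrically_subregular_with_def
      by (intro cINF_lower bdd_belowI[of _ 0]) (auto intro: less_imp_le)
    finally show ?thesis by (simp add: dist_commute)
  qed
  have error_bound: "infdist (x k) C \<le> \<gamma>s k * norm (x k - T k (x k))" for k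
  proof -
    have "(\<lambda>u. u - T k u) -` {0} = C"
      using Fix_eq[of k] by (auto simp: Fix_def)
    then show ?thesis
      using subregular[of k] in_ball[of k] unfolding metrically_subregular_with_def by auto
  qed

  obtain l where l: "0 < l" "\<forall>\<^sub>F k in sequentially. l < lam k"
  proof -
    obtain l where "0 < ereal l" "ereal l < liminf (\<lambda>k. ereal (lam k))"
      using ereal_dense2[OF lam_liminf] by auto
    then show thesis using less_LiminfD[of "ereal l"] that by fastforce
  qed
  obtain L where L: "L < 1 / \<alpha>" "\<forall>\<^sub>F k in sequentially. lam k < L"
  proof -
    obtain L where "limsup (\<lambda>k. ereal (lam k)) < ereal L" "ereal L < ereal (1 / \<alpha>)"
      using ereal_dense2[OF lam_limsup] by auto
    then show thesis using Limsup_lessD[of _ _ "ereal L"] that by fastforce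
  qed
  have L_pos: "0 < L"
  proof -
    obtain k where "lam k < L"
      using L(2) by (auto simp: eventually_sequentially)
    then show ?thesis using lam[of k] by linarith
  qed
  \<comment> \<open>\<open>M\<close> separates \<open>\<alpha>\<close> from \<open>1 / L\<close>, so that \<open>1 / M - L\<close> is a uniform gap below \<open>1 / \<alpha>\<^sub>k - \<lambda>\<^sub>k\<close>\<close>
  obtain M where M: "\<alpha> < M" "M < 1 / L"
    using L(1) L_pos \<alpha>_pos dense[of \<alpha> "1 / L"] by (auto simp: field_simps)
  have M_ev: "\<forall>\<^sub>F k in sequentially. \<alpha>s k < M"
    using Limsup_lessD[of sequentially "\<lambda>k. ereal (\<alpha>s k)" "ereal M"] \<alpha>_limsup M(1) by simp
  obtain G where G: "\<forall>\<^sub>F k in sequentially. \<gamma>s k < G"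
  proof -
    obtain G where "limsup (\<lambda>k. ereal (\<gamma>s k)) < ereal G"
      using ereal_dense2[OF \<gamma>_limsup] by auto
    then show thesis using Limsup_lessD[of _ _ "ereal G"] that by fastforce
  qed
  obtain N where N: "\<And>k. k \<ge> N \<Longrightarrow> l < lam k \<and> lam k < L \<and> \<alpha>s k < M \<and> \<gamma>s k < G"
    using eventually_conj[OF l(2) eventually_conj[OF L(2) eventually_conj[OF M_ev G]]]
    unfolding eventually_sequentially by blast

  have \<gamma>s_pos: "0 < \<gamma>s k" for k
    using subregular[of k] by (simp add: metrically_subregular_with_def)
  have G_pos: "0 < G"
    using N[of N] \<gamma>s_pos[of N] by simp
  define c where "c = l * (1 / M - L)"
  have gap: "0 < 1 / M - L"
    using M \<alpha>_pos L_pos by (simp add: field_simps)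
  then have c_pos: "0 < c"
    using l(1) by (simp add: c_def)
  \<comment> \<open>the minimum only ensures \<open>\<kappa> \<le> 1\<close>, as the contraction estimate demands\<close>
  define \<kappa> where "\<kappa> = min 1 (c / G\<^sup>2)"
  have \<kappa>: "0 < \<kappa>" "\<kappa> \<le> 1" "\<kappa> \<le> c / G\<^sup>2"
    using c_pos G_pos by (auto simp: \<kappa>_def)
  have S_infdist: "infdist (S k (x k)) C \<le> (1 - \<kappa> / 2) * infdist (x k) C" if "k \<ge> N" for k
  proof (rule infdist_contraction[OF C_nonempty \<kappa>(2)])
    fix z
    assume "z \<in> C"
    let ?r = "norm (x k - T k (x k))"
    note large = N[OF that]
    have "0 < \<alpha>s k"
      using averaged[of k] by (simp add: averaged_def)
    then have "1 / M \<le> 1 / \<alpha>s k"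
      using large by (intro divide_left_mono) auto
    then have "c \<le> lam k * (1 / \<alpha>s k - lam k)"
      unfolding c_def using l(1) gap large by (intro mult_mono) auto
    then have gain: "c * ?r\<^sup>2 \<le> lam k * (1 / \<alpha>s k - lam k) * ?r\<^sup>2"
      by (rule mult_right_mono) simp
    have "infdist (x k) C \<le> G * ?r"
      using error_bound[of k] large mult_right_mono[of "\<gamma>s k" G ?r] by simp
    then have "(infdist (x k) C)\<^sup>2 \<le> (G * ?r)\<^sup>2"
      using infdist_nonneg by (intro power_mono) auto
    then have "\<kappa> * (infdist (x k) C)\<^sup>2 \<le> c / G\<^sup>2 * (G * ?r)\<^sup>2"
      using \<kappa> c_pos by (intro mult_mono) auto
    also have "\<dots> = c * ?r\<^sup>2"
      using G_pos by (simp add: power_mult_distrib)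
    finally have "\<kappa> * (infdist (x k) C)\<^sup>2 \<le> lam k * (1 / \<alpha>s k - lam k) * ?r\<^sup>2"
      using gain by linarith
    moreover have "(norm (S k (x k) - z))\<^sup>2
        \<le> (norm (x k - z))\<^sup>2 - lam k * (1 / \<alpha>s k - lam k) * ?r\<^sup>2"
      unfolding S_def using averaged[of k] Fix_eq[of k] \<open>z \<in> C\<close> lam[of k]
      by (intro averaged_relaxation_norm_sq) auto
    ultimately show "(norm (S k (x k) - z))\<^sup>2 \<le> (norm (x k - z))\<^sup>2 - \<kappa> * (infdist (x k) C)\<^sup>2"
      by linarith
  qed
  have infdist_step: "infdist (x (Suc k)) C \<le> (1 - \<kappa> / 2) * infdist (x k) C + a k"
    if "k \<ge> N" for k
  proof -
    have "infdist (x (Suc k)) C \<le> infdist (S k (x k)) C + dist (x (Suc k)) (S k (x k))"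
      by (rule infdist_triangle)
    also have "dist (x (Suc k)) (S k (x k)) = a k"
      using a_norm[of k] by (simp add: x_step dist_norm)
    finally show ?thesis using S_infdist[OF that] by simp
  qed
  have "(\<lambda>k. infdist (x (k + N)) C) \<longlonglongrightarrow> 0"
  proof (rule perturbed_contraction_tendsto_zero)
    show "1 - \<kappa> / 2 < 1" using \<kappa> by simp
    show "summable (\<lambda>k. a (k + N))"
      using a_sums by (simp add: sums_iff summable_iff_shift)
    show "infdist (x (Suc k + N)) C \<le> (1 - \<kappa> / 2) * infdist (x (k + N)) C + a (k + N)" for k
      using infdist_step[of "k + N"] by simp
  qed (auto simp: infdist_nonneg a_nonneg)
  then have "(\<lambda>k. infdist (x k) C) \<longlonglongrightarrow> 0"
    by (rule LIMSEQ_offset)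
  then obtain z where z: "z \<in> C" "x \<longlonglongrightarrow> z"
    using quasi_Fejer_convergent[OF C_nonempty closed a_sums a_nonneg] Fejer by blast

  have projection: "metric_projection C (x 0 + (\<Sum>k. \<eta> k *\<^sub>R e k)) = z" if "affine C"
  proof (rule metric_projection_eqI[OF z(1)])
    fix y
    assume "y \<in> C"
    let ?v = "y - z" and ?w = "\<lambda>n. x 0 + (\<Sum>k<n. \<eta> k *\<^sub>R e k)"
    have "(?w n - x n) \<bullet> ?v = 0" for n
    proof (induction n)
      case (Suc n)
      have "(S n (x n) - x n) \<bullet> ?v = 0"
        using that z(1) \<open>y \<in> C\<close> S_closer by (rule closer_to_affine_imp_orthogonal)
      moreover have "?w (Suc n) - x (Suc n) = (?w n - x n) - (S n (x n) - x n)"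
        by (simp add: x_step)
      ultimately show ?case
        using Suc by (simp only: inner_diff_left[of _ _ ?v])
    qed simp
    moreover have "(\<lambda>n. (?w n - x n) \<bullet> ?v) \<longlonglongrightarrow> (x 0 + (\<Sum>k. \<eta> k *\<^sub>R e k) - z) \<bullet> ?v"
    proof -
      have "summable (\<lambda>k. \<eta> k *\<^sub>R e k)"
        using a_sums by (intro summable_of_sums_norm[of _ \<epsilon>]) (simp only: a_norm)
      then show ?thesis
        by (intro tendsto_intros z(2) summable_LIMSEQ)
    qed
    ultimately show "(x 0 + (\<Sum>k. \<eta> k *\<^sub>R e k) - z) \<bullet> (y - z) = 0"
      by (simp add: LIMSEQ_const_iff)
  qed
  show ?thesis
  proof (intro conjI impI)
    show "\<exists>z\<in>C. x \<longlonglongrightarrow> z" using z by blast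
    assume "affine C"
    note limit = z(2)[folded projection[OF this]]
    show "x \<longlonglongrightarrow> metric_projection C (x 0 + (\<Sum>k. \<eta> k *\<^sub>R e k))"
      by (rule limit)
    show "x \<longlonglongrightarrow> metric_projection C (x 0)" if "\<forall>k. \<eta> k *\<^sub>R e k = 0"
      using limit that by simp
  qed
qed

end
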